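(* Let $\Omega_1=\{(\alpha_{\mathbf k},\beta_{\mathbf k})\}_{|\mathbf k|\le 1}$ be a commutative family of pairs of positive numbers (i.e. $\beta_{10}\alpha_{00}=\alpha_{01}\beta_{00}$), and assume that $M(\Omega_1)\ge 0$. Then there always exists a commutative extension $\hat\Omega_3$ of $\Omega_1$ such that $M(\hat\Omega_3)$ is a flat extension of $M(\Omega_1)$ (that is, $\operatorname{rank}M(\hat\Omega_3)=\operatorname{rank}M(\Omega_1)$), and $M_x(\hat\Omega_3)\ge 0$ and $M_y(\hat\Omega_3)\ge 0$. As a consequence, $\Omega_1$ admits a subnormal completion.
   Context: Notation: $\mathbb Z_+=\{0,1,2,\dots\}$, $\varepsilon_1=(1,0)$, $\varepsilon_2=(0,1)$, $|\mathbf k|=k_1+k_2$ for $\mathbf k=(k_1,k_2)\in\mathbb Z_+^2$. For matrices, $\ge 0$ means positive semi-definite. Weight families: a family $\Omega_m=\{(\alpha_{\mathbf k},\beta_{\mathbf k})\}_{|\mathbf k|\le m}$ of pairs of positive numbers is commutative if $\beta_{\mathbf k+\varepsilon_1}\alpha_{\mathbf k}=\alpha_{\mathbf k+\varepsilon_2}\beta_{\mathbf k}$ whenever $|\mathbf k+\varepsilon_i|\le m$ ($i=1,2$). A family $\hat\Omega_3=\{(\hat\alpha_{\mathbf k},\hat\beta_{\mathbf k})\}_{|\mathbf k|\le 3}$ of pairs of positive numbers is an extension of $\Omega_1$ if $(\hat\alpha_{\mathbf k},\hat\beta_{\mathbf k})=(\alpha_{\mathbf k},\beta_{\mathbf k})$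 for $|\mathbf k|\le 1$. (Its moments go up to degree 4, hence "quartic"; those of $\Omega_1$ go up to degree 2, hence "quadratic".) Moments: for a commutative family $\Omega_m$ and $i,j\ge0$ with $i+j\le m+1$, the moment $\gamma_{ij}$ is the product of the squares of the weights along any nondecreasing lattice path from $(0,0)$ to $(j,i)$ (a horizontal step from $\mathbf k$ to $\mathbf k+\varepsilon_1$ contributes $\alpha_{\mathbf k}^2$, a vertical step from $\mathbf k$ to $\mathbf k+\varepsilon_2$ contributes $\beta_{\mathbf k}^2$); $\gamma_{00}=1$. By commutativity this is independent of the path. (The first index of $\gamma_{ij}$ counts vertical steps, the second counts horizontal steps.) Moment and localizing matrices (all index pairs $\mathbf u,\mathbf v\in\mathbb Z_+^2$): $M(\Omega_1):=(\gamma_{\mathbf u+\mathbf v})_{|\mathbf u|,|\mathbf v|\le 1}$, that is, $$M(\Omega_1)=\begin{pmatrix}1&\gamma_{01}&\gamma_{10}\\ \gamma_{01}&\gamma_{02}&\gamma_{11}\\ \gamma_{10}&\gamma_{11}&\gamma_{20}\end{pmatrix}=\begin{pmatrix}1&\alpha_{00}^2&\beta_{00}^2\\ \alpha_{00}^2&\alpha_{00}^2\alpha_{10}^2&\beta_{00}^2\alpha_{01}^2\\ \beta_{00}^2&\beta_{00}^2\alpha_{01}^2&\beta_{00}^2\beta_{01}^2\end{pmatrix};$$ and, with $\gamma$ now denoting the moments of $\hat\Omega_3$, $M(\hat\Omega_3):=(\gamma_{\mathbf u+\mathbf v})_{|\mathbf u|,|\mathbf v|\le 2}$ (a $6\times 6$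 matrix), $M_x(\hat\Omega_3):=(\gamma_{\mathbf u+\mathbf v+(0,1)})_{|\mathbf u|,|\mathbf v|\le 1}$ and $M_y(\hat\Omega_3):=(\gamma_{\mathbf u+\mathbf v+(1,0)})_{|\mathbf u|,|\mathbf v|\le 1}$ ($3\times3$ matrices). 2-variable weighted shifts: for bounded positive double sequences $\alpha_{\mathbf k},\beta_{\mathbf k}$ ($\mathbf k\in\mathbb Z_+^2$), the 2-variable weighted shift $\mathbf T=(T_1,T_2)$ on $\ell^2(\mathbb Z_+^2)$ (canonical orthonormal basis $\{e_{\mathbf k}\}$) is $T_1e_{\mathbf k}=\alpha_{\mathbf k}e_{\mathbf k+\varepsilon_1}$, $T_2e_{\mathbf k}=\beta_{\mathbf k}e_{\mathbf k+\varepsilon_2}$. It is subnormal if it is the restriction of a commuting pair of normal operators to a common invariant subspace. A subnormal completion of $\Omega_1$ is a subnormal 2-variable weighted shift whose weights agree with $(\alpha_{\mathbf k},\beta_{\mathbf k})$ for $|\mathbf k|\le 1$. *)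

theory Defs
  imports "HOL-Analysis.Analysis"
begin

abbreviation eps1 :: "nat \<times> nat" where "eps1 \<equiv> (1, 0)"
abbreviation eps2 :: "nat \<times> nat" where "eps2 \<equiv> (0, 1)"

definition deg :: "nat \<times> nat \<Rightarrow> nat" where
  "deg k = fst k + snd k"

text \<open>A family indexed by the \<open>k\<close> with \<open>|k| \<le> m\<close> is represented by two functions on all of
  \<open>nat \<times> nat\<close>; their values at \<open>k\<close> with \<open>|k| > m\<close> are irrelevant.\<close>

definition commutative_family ::
    "nat \<Rightarrow> (nat \<times> nat \<Rightarrow> real) \<Rightarrow> (nat \<times> nat \<Rightarrow> real) \<Rightarrow> bool" where
  "commutative_family m \<alpha> \<beta> \<longleftrightarrow>
     (\<forall>k. deg k \<le> m \<longrightarrow> \<alpha> k > 0 \<and> \<beta> k > 0) \<and>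
     (\<forall>k. deg (k + eps1) \<le> m \<and> deg (k + eps2) \<le> m \<longrightarrow>
        \<beta> (k + eps1) * \<alpha> k = \<alpha> (k + eps2) * \<beta> k)"

definition agree_upto ::
    "nat \<Rightarrow> (nat \<times> nat \<Rightarrow> real) \<Rightarrow> (nat \<times> nat \<Rightarrow> real)
      \<Rightarrow> (nat \<times> nat \<Rightarrow> real) \<Rightarrow> (nat \<times> nat \<Rightarrow> real) \<Rightarrow> bool" where
  "agree_upto m \<alpha> \<beta> \<alpha>' \<beta>' \<longleftrightarrow> (\<forall>k. deg k \<le> m \<longrightarrow> \<alpha>' k = \<alpha> k \<and> \<beta>' k = \<beta> k)"

datatype step = Horizontal | Vertical

fun path_weight ::
    "(nat \<times> nat \<Rightarrow> real) \<Rightarrow> (nat \<times> nat \<Rightarrow> real) \<Rightarrow> nat \<times> nat \<Rightarrow> step list \<Rightarrow> real" where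
  "path_weight \<alpha> \<beta> k [] = 1"
| "path_weight \<alpha> \<beta> k (Horizontal # p) = (\<alpha> k)\<^sup>2 * path_weight \<alpha> \<beta> (k + eps1) p"
| "path_weight \<alpha> \<beta> k (Vertical # p) = (\<beta> k)\<^sup>2 * path_weight \<alpha> \<beta> (k + eps2) p"

text \<open>The moment \<open>\<gamma>\<^sub>i\<^sub>j\<close> is taken along the path from \<open>(0,0)\<close> to \<open>(j,i)\<close> that makes all its
  horizontal steps first; \<open>path_weight_eq_moment\<close> below shows that for a commutative family every
  other path gives the same value.  Note the order of the indices: the first one counts
  vertical steps, the second one horizontal steps.\<close>

definition moment ::
    "(nat \<times> nat \<Rightarrow> real) \<Rightarrow> (nat \<times> nat \<Rightarrow> real) \<Rightarrow> nat \<times> nat \<Rightarrow> real" where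
  "moment \<alpha> \<beta> u =
     path_weight \<alpha> \<beta> (0, 0) (replicate (snd u) Horizontal @ replicate (fst u) Vertical)"

lemma path_weight_swap:
  assumes "commutative_family m \<alpha> \<beta>" "deg k + 1 \<le> m"
  shows "path_weight \<alpha> \<beta> k (Vertical # Horizontal # p) =
         path_weight \<alpha> \<beta> k (Horizontal # Vertical # p)"
proof -
  have "\<beta> (k + eps1) * \<alpha> k = \<alpha> (k + eps2) * \<beta> k"
    using assms by (cases k) (simp add: commutative_family_def deg_def)
  then have "(\<beta> k)\<^sup>2 * (\<alpha> (k + eps2))\<^sup>2 = (\<alpha> k)\<^sup>2 * (\<beta> (k + eps1))\<^sup>2"
    by (metis mult.commute power_mult_distrib)
  moreover have "k + eps2 + eps1 = k + eps1 + eps2"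
    by (cases k) simp
  ultimately show ?thesis
    by simp
qed

lemma path_weight_move_vertical:
  assumes "commutative_family m \<alpha> \<beta>" "deg k + a \<le> m"
  shows "path_weight \<alpha> \<beta> k (Vertical # replicate a Horizontal @ p) =
         path_weight \<alpha> \<beta> k (replicate a Horizontal @ Vertical # p)"
  using assms(2)
proof (induction a arbitrary: k)
  case (Suc a)
  have "path_weight \<alpha> \<beta> k (Vertical # replicate (Suc a) Horizontal @ p) =
        path_weight \<alpha> \<beta> k (Horizontal # Vertical # replicate a Horizontal @ p)"
    using path_weight_swap[OF assms(1), of k] Suc.prems by simp
  then show ?case
    using Suc.IH[of "k + eps1"] Suc.prems by (simp add: deg_def)
qed simp

lemma path_weight_sorted:
  assumes "commutative_family m \<alpha> \<beta>" "deg k + length p \<le> m + 1"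
  shows "path_weight \<alpha> \<beta> k p =
         path_weight \<alpha> \<beta> k (replicate (count_list p Horizontal) Horizontal @
                            replicate (count_list p Vertical) Vertical)"
  using assms(2)
proof (induction p arbitrary: k)
  case (Cons s p)
  have len: "count_list p Horizontal \<le> length p"
    by (rule count_le_length)
  show ?case
  proof (cases s)
    case Horizontal
    then show ?thesis
      using Cons.IH[of "k + eps1"] Cons.prems by (simp add: deg_def)
  next
    case Vertical
    then show ?thesis
      using Cons.IH[of "k + eps2"] Cons.prems len
        path_weight_move_vertical[OF assms(1), of k "count_list p Horizontal"
          "replicate (count_list p Vertical) Vertical"]
      by (simp add: deg_def)
  qed
qed simp

lemma path_weight_eq_moment:
  assumes "commutative_family m \<alpha> \<beta>"
    and "count_list p Vertical = i" "count_list p Horizontal = j" "length p \<le> m + 1"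
  shows "path_weight \<alpha> \<beta> (0, 0) p = moment \<alpha> \<beta> (i, j)"
  using path_weight_sorted[OF assms(1), of "(0, 0)" p] assms(2-4)
  by (simp add: moment_def deg_def)

typedef index1 = "{u :: nat \<times> nat. deg u \<le> 1}" morphisms pair1 Index1
  by (rule exI[of _ "(0, 0)"]) (simp add: deg_def)

typedef index2 = "{u :: nat \<times> nat. deg u \<le> 2}" morphisms pair2 Index2
  by (rule exI[of _ "(0, 0)"]) (simp add: deg_def)

lemma finite_deg_le: "finite {u. deg u \<le> m}"
  by (rule finite_subset[of _ "{..m} \<times> {..m}"]) (auto simp: deg_def)

instance index1 :: finite
proof
  have "(UNIV :: index1 set) = Index1 ` {u. deg u \<le> 1}"
    using pair1_inverse pair1 by (metis UNIV_eq_I image_eqI)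
  then show "finite (UNIV :: index1 set)"
    using finite_deg_le by (metis finite_imageI)
qed

instance index2 :: finite
proof
  have "(UNIV :: index2 set) = Index2 ` {u. deg u \<le> 2}"
    using pair2_inverse pair2 by (metis UNIV_eq_I image_eqI)
  then show "finite (UNIV :: index2 set)"
    using finite_deg_le by (metis finite_imageI)
qed

definition M_quadratic ::
    "(nat \<times> nat \<Rightarrow> real) \<Rightarrow> (nat \<times> nat \<Rightarrow> real) \<Rightarrow> real ^ index1 ^ index1" where
  "M_quadratic \<alpha> \<beta> = (\<chi> u v. moment \<alpha> \<beta> (pair1 u + pair1 v))"

definition M_quartic ::
    "(nat \<times> nat \<Rightarrow> real) \<Rightarrow> (nat \<times> nat \<Rightarrow> real) \<Rightarrow> real ^ index2 ^ index2" where
  "M_quartic \<alpha> \<beta> = (\<chi> u v. moment \<alpha> \<beta> (pair2 u + pair2 v))"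

definition M_x ::
    "(nat \<times> nat \<Rightarrow> real) \<Rightarrow> (nat \<times> nat \<Rightarrow> real) \<Rightarrow> real ^ index1 ^ index1" where
  "M_x \<alpha> \<beta> = (\<chi> u v. moment \<alpha> \<beta> (pair1 u + pair1 v + (0, 1)))"

definition M_y ::
    "(nat \<times> nat \<Rightarrow> real) \<Rightarrow> (nat \<times> nat \<Rightarrow> real) \<Rightarrow> real ^ index1 ^ index1" where
  "M_y \<alpha> \<beta> = (\<chi> u v. moment \<alpha> \<beta> (pair1 u + pair1 v + (1, 0)))"

definition psd :: "real ^ 'n ^ 'n \<Rightarrow> bool" where
  "psd A \<longleftrightarrow> transpose A = A \<and> (\<forall>x. 0 \<le> x \<bullet> (A *v x))"

text \<open>Operators are total functions on \<open>'i \<Rightarrow> complex\<close> of which only the values on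
  \<open>ell2\<close> matter.\<close>

definition ell2 :: "('i \<Rightarrow> complex) set" where
  "ell2 = {f. (\<lambda>i. (cmod (f i))\<^sup>2) summable_on UNIV}"

definition ell2_inner :: "('i \<Rightarrow> complex) \<Rightarrow> ('i \<Rightarrow> complex) \<Rightarrow> complex" where
  "ell2_inner f g = (\<Sum>\<^sub>\<infinity>i. f i * cnj (g i))"

definition ell2_norm :: "('i \<Rightarrow> complex) \<Rightarrow> real" where
  "ell2_norm f = sqrt (\<Sum>\<^sub>\<infinity>i. (cmod (f i))\<^sup>2)"

definition basis_vec :: "'i \<Rightarrow> 'i \<Rightarrow> complex" where
  "basis_vec k = (\<lambda>i. if i = k then 1 else 0)"

definition bounded_op :: "(('i \<Rightarrow> complex) \<Rightarrow> ('j \<Rightarrow> complex)) \<Rightarrow> bool" where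
  "bounded_op T \<longleftrightarrow>
     (\<forall>f\<in>ell2. T f \<in> ell2) \<and>
     (\<forall>f\<in>ell2. \<forall>g\<in>ell2. T (\<lambda>i. f i + g i) = (\<lambda>j. T f j + T g j)) \<and>
     (\<forall>c. \<forall>f\<in>ell2. T (\<lambda>i. c * f i) = (\<lambda>j. c * T f j)) \<and>
     (\<exists>C. \<forall>f\<in>ell2. ell2_norm (T f) \<le> C * ell2_norm f)"

definition adjoint_of ::
    "(('i \<Rightarrow> complex) \<Rightarrow> ('i \<Rightarrow> complex)) \<Rightarrow> (('i \<Rightarrow> complex) \<Rightarrow> ('i \<Rightarrow> complex)) \<Rightarrow> bool" where
  "adjoint_of S T \<longleftrightarrow> bounded_op S \<and>
     (\<forall>f\<in>ell2. \<forall>g\<in>ell2. ell2_inner (T f) g = ell2_inner f (S g))"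

definition normal_op :: "(('i \<Rightarrow> complex) \<Rightarrow> ('i \<Rightarrow> complex)) \<Rightarrow> bool" where
  "normal_op T \<longleftrightarrow> bounded_op T \<and>
     (\<exists>S. adjoint_of S T \<and> (\<forall>f\<in>ell2. T (S f) = S (T f)))"

definition isometric_op :: "(('i \<Rightarrow> complex) \<Rightarrow> ('j \<Rightarrow> complex)) \<Rightarrow> bool" where
  "isometric_op U \<longleftrightarrow> bounded_op U \<and>
     (\<forall>f\<in>ell2. \<forall>g\<in>ell2. ell2_inner (U f) (U g) = ell2_inner f g)"

text \<open>The inclusion of the Hilbert space into the larger one on which \<open>N1\<close>, \<open>N2\<close> act is the
  isometry \<open>U\<close>; its range is automatically closed, is invariant under both normal operators, and
  \<open>T1\<close>, \<open>T2\<close> are the restrictions of \<open>N1\<close>, \<open>N2\<close> to it.  It is no loss of generality to take the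
  larger space to be \<open>\<ell>\<^sup>2\<close> over the natural numbers: the smallest subspace that contains the range
  and reduces \<open>N1\<close> and \<open>N2\<close> is separable and infinite-dimensional, hence unitarily equivalent to
  this space.\<close>

definition subnormal_pair ::
    "((nat \<times> nat \<Rightarrow> complex) \<Rightarrow> (nat \<times> nat \<Rightarrow> complex)) \<Rightarrow>
     ((nat \<times> nat \<Rightarrow> complex) \<Rightarrow> (nat \<times> nat \<Rightarrow> complex)) \<Rightarrow> bool" where
  "subnormal_pair T1 T2 \<longleftrightarrow>
     (\<exists>(N1 :: (nat \<Rightarrow> complex) \<Rightarrow> (nat \<Rightarrow> complex))
       (N2 :: (nat \<Rightarrow> complex) \<Rightarrow> (nat \<Rightarrow> complex))
       (U :: (nat \<times> nat \<Rightarrow> complex) \<Rightarrow> (nat \<Rightarrow> complex)).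
        normal_op N1 \<and> normal_op N2 \<and> (\<forall>f\<in>ell2. N1 (N2 f) = N2 (N1 f)) \<and>
        isometric_op U \<and>
        N1 ` (U ` ell2) \<subseteq> U ` ell2 \<and> N2 ` (U ` ell2) \<subseteq> U ` ell2 \<and>
        (\<forall>f\<in>ell2. N1 (U f) = U (T1 f)) \<and> (\<forall>f\<in>ell2. N2 (U f) = U (T2 f)))"

definition weighted_shift ::
    "(nat \<times> nat \<Rightarrow> real) \<Rightarrow> (nat \<times> nat \<Rightarrow> real) \<Rightarrow>
     ((nat \<times> nat \<Rightarrow> complex) \<Rightarrow> (nat \<times> nat \<Rightarrow> complex)) \<Rightarrow>
     ((nat \<times> nat \<Rightarrow> complex) \<Rightarrow> (nat \<times> nat \<Rightarrow> complex)) \<Rightarrow> bool" where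
  "weighted_shift \<alpha> \<beta> T1 T2 \<longleftrightarrow>
     (\<forall>k. \<alpha> k > 0 \<and> \<beta> k > 0) \<and> bounded (range \<alpha>) \<and> bounded (range \<beta>) \<and>
     bounded_op T1 \<and> bounded_op T2 \<and>
     (\<forall>k. T1 (basis_vec k) = (\<lambda>i. complex_of_real (\<alpha> k) * basis_vec (k + eps1) i)) \<and>
     (\<forall>k. T2 (basis_vec k) = (\<lambda>i. complex_of_real (\<beta> k) * basis_vec (k + eps2) i))"

definition has_subnormal_completion ::
    "nat \<Rightarrow> (nat \<times> nat \<Rightarrow> real) \<Rightarrow> (nat \<times> nat \<Rightarrow> real) \<Rightarrow> bool" where
  "has_subnormal_completion m \<alpha> \<beta> \<longleftrightarrow>
     (\<exists>\<alpha>' \<beta>' T1 T2. weighted_shift \<alpha>' \<beta>' T1 T2 \<and> subnormal_pair T1 T2 \<and>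
        agree_upto m \<alpha> \<beta> \<alpha>' \<beta>')"

end

theory Submission
  imports Defs
begin

text \<open>
  Write \<open>M\<close> for the quadratic moment matrix.  Everything follows once \<open>M\<close> is recognised as the
  moment matrix of a measure \<open>\<mu> = \<Sum>\<^sub>l w\<^sub>l \<delta>(x\<^sub>l, y\<^sub>l)\<close> on the closed first quadrant which has exactly
  \<open>rank M\<close> atoms (\<open>quadratic_moment_problem\<close>).

  Such a measure exists because the entries of \<open>M\<close> are positive.  If \<open>M\<close> has rank one, the mean
  \<open>(\<gamma>\<^sub>0\<^sub>1, \<gamma>\<^sub>1\<^sub>0)\<close> is the only atom.  If it has rank two, it is the Gram matrix of
  three vectors in the plane, any two of which form an acute angle; a rotation
  moves all three into the open first quadrant, and the two coordinate rows of the rotated vectors,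
  normalised to have first entry \<open>1\<close>, are the atoms (\<open>rotate_into_open_quadrant\<close>,
  \<open>singular_as_two_squares\<close>).  If \<open>M\<close> is invertible, one lowers its corner entry \<open>\<gamma>\<^sub>0\<^sub>0 = 1\<close> until the
  determinant vanishes.  This changes no other entry and leaves the corner positive, so the
  argument for rank two applies again; the mass that was taken away becomes a third atom at the origin.

  Given \<open>\<mu>\<close>, all its moments are positive, since \<open>\<gamma>\<^sub>1\<^sub>1 > 0\<close> forces an atom off the axes.
  The square roots of quotients of neighbouring moments are therefore the weights of a commuting
  2-variable weighted shift whose moments are those of \<open>\<mu>\<close>, and they extend the given family.  The
  localizing matrices are positive since the atoms have nonnegative coordinates.  Flatness holds since
  the atoms are affinely independent: on them every quadratic monomial coincides with an
  affine function, so \<open>M_quartic = W M_quadratic W\<^sup>T\<close> for a suitable matrix \<open>W\<close>.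

  For subnormality, the measure is spread over tori: on \<open>\<ell>\<^sup>2(\<int>\<^sup>2 \<times> {l})\<close> take the two bilateral shifts
  multiplied by the constants \<open>\<surd>x\<^sub>l\<close> and \<open>\<surd>y\<^sub>l\<close>.  The direct sums over \<open>l\<close> are commuting normal
  operators, and the weighted shift is their restriction to the range of the isometry that sends
  \<open>e\<^sub>k\<close> to \<open>\<Sum>\<^sub>l \<surd>(w\<^sub>l x\<^sub>l^k\<^sub>1 y\<^sub>l^k\<^sub>2 / \<gamma>\<^sub>k) e(k, l)\<close>.
\<close>

section \<open>Positive Gram matrices in the plane\<close>

lemma ex_strictly_between_finite_sets:
  fixes A B :: "real set"
  assumes "finite A" "finite B" and less: "\<And>a b. a \<in> A \<Longrightarrow> b \<in> B \<Longrightarrow> a < b"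
  obtains s where "\<And>a. a \<in> A \<Longrightarrow> a < s" "\<And>b. b \<in> B \<Longrightarrow> s < b"
proof -
  consider "A = {}" | "B = {}" | "A \<noteq> {}" "B \<noteq> {}" by blast
  then show thesis
  proof cases
    case 1
    then show thesis
      using that[of "Min (insert 0 B) - 1"] assms(2) Min_le[of "insert 0 B"]
      by (smt (verit) empty_iff finite_insert insertCI)
  next
    case 2
    then show thesis
      using that[of "Max (insert 0 A) + 1"] assms(1) Max_ge[of "insert 0 A"]
      by (smt (verit) empty_iff finite_insert insertCI)
  next
    case 3
    then have "Max A < Min B"
      using assms by auto
    then obtain s where "Max A < s" "s < Min B"
      using dense by blast
    then show thesis
      using that[of s] assms(1,2) 3 by simp
  qed
qed

text \<open>In matrix form: a positive matrix that is a Gram matrix of vectors \<open>(p i, q i)\<close> in the plane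
  is also one of vectors with positive coordinates.  The new coordinate axes are spanned by
  \<open>(1, - s)\<close> and \<open>(s, 1)\<close>; the vectors have positive coordinates there if and only if
  \<open>s * q i < p i\<close> and \<open>- q i < s * p i\<close>, and the acute angles say that no lower bound for \<open>s\<close> meets an upper one.\<close>

lemma rotate_into_open_quadrant:
  fixes p q :: "'i \<Rightarrow> real"
  assumes "finite I" and p: "\<And>i. i \<in> I \<Longrightarrow> 0 < p i"
    and acute: "\<And>i j. i \<in> I \<Longrightarrow> j \<in> I \<Longrightarrow> 0 < p i * p j + q i * q j"
  obtains u v where "\<And>i. i \<in> I \<Longrightarrow> 0 < u i" "\<And>i. i \<in> I \<Longrightarrow> 0 < v i"
    and "\<And>i j. u i * u j + v i * v j = p i * p j + q i * q j"
proof -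
  \<comment> \<open>The lower bound \<open>0\<close> settles \<open>s * q i < p i\<close> for those \<open>i\<close> with \<open>q i \<le> 0\<close>.\<close>
  define A where "A = insert 0 ((\<lambda>i. - (q i / p i)) ` I)"
  define B where "B = (\<lambda>i. p i / q i) ` {i \<in> I. 0 < q i}"
  have "a < b" if "a \<in> A" "b \<in> B" for a b
  proof -
    from that obtain j where j: "j \<in> I" "0 < q j" "b = p j / q j"
      by (auto simp: B_def)
    from that consider "a = 0" | i where "i \<in> I" "a = - (q i / p i)"
      by (auto simp: A_def)
    then show ?thesis
    proof cases
      case 1
      then show ?thesis using j p by simp
    next
      case 2
      have "b - a = (p i * p j + q i * q j) / (p i * q j)"
        using j p[OF 2(1)] by (simp add: 2(2) field_simps)
      moreover have "\<dots> > 0"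
        using 2 j p acute by simp
      ultimately show ?thesis by simp
    qed
  qed
  moreover have "finite A" "finite B"
    using \<open>finite I\<close> by (simp_all add: A_def B_def)
  ultimately obtain s where sA: "\<And>a. a \<in> A \<Longrightarrow> a < s" and sB: "\<And>b. b \<in> B \<Longrightarrow> s < b"
    using ex_strictly_between_finite_sets[of A B] by blast
  have "0 < s"
    using sA[of 0] by (simp add: A_def)
  define r where "r = sqrt (1 + s\<^sup>2)"
  have r: "0 < r" "r * r = 1 + s\<^sup>2"
    by (auto simp: r_def add_pos_nonneg)
  show thesis
  proof (rule that)
    fix i assume i: "i \<in> I"
    have "s * q i < p i"
    proof (cases "0 < q i")
      case True
      then have "s < p i / q i"
        using i by (intro sB) (auto simp: B_def)
      then show ?thesis
        using True by (simp add: field_simps)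
    next
      case False
      then show ?thesis
        using \<open>0 < s\<close> p[OF i] by (smt (verit) mult_nonneg_nonpos)
    qed
    then show "0 < (p i - s * q i) / r"
      using r by simp
    have "- (q i / p i) < s"
      using i by (intro sA) (auto simp: A_def)
    then show "0 < (s * p i + q i) / r"
      using r p[OF i] by (simp add: field_simps)
  next
    fix i j
    have "(p i - s * q i) / r * ((p j - s * q j) / r) + (s * p i + q i) / r * ((s * p j + q j) / r)
        = (1 + s\<^sup>2) * (p i * p j + q i * q j) / (r * r)"
      by (simp add: add_divide_distrib[symmetric] algebra_simps power2_eq_square)
    then show "(p i - s * q i) / r * ((p j - s * q j) / r) + (s * p i + q i) / r * ((s * p j + q j) / r)
        = p i * p j + q i * q j"
      using r by (metis less_irrefl mult_pos_pos nonzero_mult_div_cancel_left)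
  qed
qed

text \<open>The hypotheses say that the symmetric matrix with rows \<open>(s, a, b)\<close>, \<open>(a, c, e)\<close>, \<open>(b, e, d)\<close> is
  positive semidefinite and singular.  Its Cholesky factorisation then has only two
  nonzero columns, \<open>p\<close> and \<open>g\<close> below, which exhibits it as a Gram matrix in the plane; the coordinates
  of the rotated vectors make up \<open>u\<close> and \<open>v\<close>.\<close>

lemma singular_as_two_squares:
  fixes s a b c e d :: real
  assumes pos: "0 < s" "0 < a" "0 < b" "0 < c" "0 < e" "0 < d"
    and minors: "a\<^sup>2 \<le> s * c" "b\<^sup>2 \<le> s * d"
    and singular: "(s * c - a\<^sup>2) * (s * d - b\<^sup>2) = (s * e - a * b)\<^sup>2"
  obtains u0 u1 u2 v0 v1 v2 where
    "0 < u0" "0 < u1" "0 < u2" "0 < v0" "0 < v1" "0 < v2"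
    "u0 * u0 + v0 * v0 = s" "u0 * u1 + v0 * v1 = a" "u0 * u2 + v0 * v2 = b"
    "u1 * u1 + v1 * v1 = c" "u1 * u2 + v1 * v2 = e" "u2 * u2 + v2 * v2 = d"
proof -
  define r where "r = sqrt s"
  have r: "0 < r" "r * r = s"
    using pos by (auto simp: r_def)
  define q1 where "q1 = sqrt (s * c - a\<^sup>2)"
  \<comment> \<open>The sign makes \<open>q1 * q2\<close> equal to the off-diagonal entry, not just up to sign.\<close>
  define q2 where "q2 = (if a * b \<le> s * e then 1 else - 1) * sqrt (s * d - b\<^sup>2)"
  have "sqrt (s * c - a\<^sup>2) * sqrt (s * d - b\<^sup>2) = \<bar>s * e - a * b\<bar>"
    by (simp add: real_sqrt_mult[symmetric] singular)
  then have q: "q1 * q1 = s * c - a\<^sup>2" "q1 * q2 = s * e - a * b" "q2 * q2 = s * d - b\<^sup>2"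
    using minors by (auto simp: q1_def q2_def)
  define p where "p = (\<lambda>i :: nat. if i = 0 then r else if i = 1 then a / r else b / r)"
  define g where "g = (\<lambda>i :: nat. if i = 0 then 0 else if i = 1 then q1 / r else q2 / r)"
  have gram: "p 0 * p 0 + g 0 * g 0 = s" "p 0 * p 1 + g 0 * g 1 = a" "p 0 * p 2 + g 0 * g 2 = b"
    "p 1 * p 1 + g 1 * g 1 = c" "p 1 * p 2 + g 1 * g 2 = e" "p 2 * p 2 + g 2 * g 2 = d"
    using r q pos by (auto simp: p_def g_def add_divide_distrib[symmetric] power2_eq_square)
  have sym: "p i * p j + g i * g j = p j * p i + g j * g i" for i j
    by simp
  have acute: "0 < p i * p j + g i * g j" if "i \<in> {0, 1, 2}" "j \<in> {0, 1, 2}" for i j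
  proof -
    have "p i * p j + g i * g j \<in> {s, a, b, c, e, d}"
      using that gram sym by (metis insert_iff singletonD)
    then show ?thesis using pos by auto
  qed
  have pp: "0 < p i" for i
    using pos r by (simp add: p_def)
  obtain u v where uv: "\<And>i. i \<in> {0, 1, 2} \<Longrightarrow> 0 < u i" "\<And>i. i \<in> {0, 1, 2} \<Longrightarrow> 0 < v i"
    "\<And>i j. u i * u j + v i * v j = p i * p j + g i * g j"
    by (rule rotate_into_open_quadrant[of "{0, 1, 2}" p g]) (use pp acute in auto)
  show thesis
    by (rule that[of "u 0" "u 1" "u 2" "v 0" "v 1" "v 2"]) (use gram in \<open>simp_all add: uv\<close>)
qed

section \<open>Finitely atomic solutions of the quadratic moment problem\<close>

text \<open>The moments of \<open>\<Sum>\<^sub>l w\<^sub>l \<delta>(x\<^sub>l, y\<^sub>l)\<close>.  The first component of the index is the exponent of \<open>y\<close>, in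
  agreement with \<open>moment\<close>, whose first index counts vertical steps.\<close>

definition atomic_moment ::
    "nat \<Rightarrow> (nat \<Rightarrow> real) \<Rightarrow> (nat \<Rightarrow> real) \<Rightarrow> (nat \<Rightarrow> real) \<Rightarrow> nat \<times> nat \<Rightarrow> real" where
  "atomic_moment n w x y u = (\<Sum>l<n. w l * (x l ^ snd u * y l ^ fst u))"

text \<open>Equivalently, the \<open>n\<close> atoms are affinely independent.  Flatness comes from
  interpolating the quadratic monomials.\<close>

definition affinely_interpolating :: "nat \<Rightarrow> (nat \<Rightarrow> real) \<Rightarrow> (nat \<Rightarrow> real) \<Rightarrow> bool" where
  "affinely_interpolating n x y \<longleftrightarrow>
     (\<forall>f. \<exists>c0 c1 c2. \<forall>l<n. f l = c0 + c1 * x l + c2 * y l)"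

lemma affinely_interpolating_one: "affinely_interpolating (Suc 0) x y"
proof (unfold affinely_interpolating_def, intro allI)
  fix f :: "nat \<Rightarrow> real"
  show "\<exists>c0 c1 c2. \<forall>l<Suc 0. f l = c0 + c1 * x l + c2 * y l"
    by (rule exI[of _ "f 0"], rule exI[of _ 0], rule exI[of _ 0]) simp
qed

lemma affinely_interpolating_two:
  assumes "x 0 \<noteq> x 1 \<or> y 0 \<noteq> y 1"
  shows "affinely_interpolating 2 x y"
proof (unfold affinely_interpolating_def, intro allI)
  fix f :: "nat \<Rightarrow> real"
  have less2: "(\<forall>l<2. P l) \<longleftrightarrow> P 0 \<and> P 1" for P :: "nat \<Rightarrow> bool"
    by (auto simp: less_2_cases_iff)
  show "\<exists>c0 c1 c2. \<forall>l<2. f l = c0 + c1 * x l + c2 * y l"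
    using assms
  proof
    assume "x 0 \<noteq> x 1"
    define k where "k = (f 1 - f 0) / (x 1 - x 0)"
    have "k * (x 1 - x 0) = f 1 - f 0"
      using \<open>x 0 \<noteq> x 1\<close> by (simp add: k_def)
    then show ?thesis
      unfolding less2
      by (intro exI[of _ "f 0 - k * x 0"] exI[of _ k] exI[of _ 0]) (simp add: algebra_simps)
  next
    assume "y 0 \<noteq> y 1"
    define k where "k = (f 1 - f 0) / (y 1 - y 0)"
    have "k * (y 1 - y 0) = f 1 - f 0"
      using \<open>y 0 \<noteq> y 1\<close> by (simp add: k_def)
    then show ?thesis
      unfolding less2
      by (intro exI[of _ "f 0 - k * y 0"] exI[of _ 0] exI[of _ k]) (simp add: algebra_simps)
  qed
qed

lemma affinely_interpolating_three:
  assumes "x 2 = 0" "y 2 = 0" and det: "x 0 * y 1 - x 1 * y 0 \<noteq> 0"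
  shows "affinely_interpolating 3 x y"
proof (unfold affinely_interpolating_def, intro allI)
  fix f :: "nat \<Rightarrow> real"
  define D where "D = x 0 * y 1 - x 1 * y 0"
  define g where "g l = f l - f 2" for l
  have less3: "(\<forall>l<3. P l) \<longleftrightarrow> P 0 \<and> P 1 \<and> P 2" for P :: "nat \<Rightarrow> bool"
    by (auto simp: numeral_3_eq_3 less_Suc_eq numeral_2_eq_2)
  have "g 0 = (g 0 * y 1 - g 1 * y 0) / D * x 0 + (x 0 * g 1 - x 1 * g 0) / D * y 0"
    "g 1 = (g 0 * y 1 - g 1 * y 0) / D * x 1 + (x 0 * g 1 - x 1 * g 0) / D * y 1"
    using det by (simp_all add: D_def[symmetric] add_divide_distrib[symmetric])
      (simp_all add: D_def field_simps)
  then show "\<exists>c0 c1 c2. \<forall>l<3. f l = c0 + c1 * x l + c2 * y l"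
    unfolding less3
    by (intro exI[of _ "f 2"] exI[of _ "(g 0 * y 1 - g 1 * y 0) / D"]
        exI[of _ "(x 0 * g 1 - x 1 * g 0) / D"]) (auto simp: g_def assms)
qed

lemma quadratic_form_minors:
  fixes A B C :: real
  assumes form: "\<And>x y. 0 \<le> A * x\<^sup>2 + 2 * B * x * y + C * y\<^sup>2"
  shows "0 \<le> A" "0 \<le> C" "B\<^sup>2 \<le> A * C"
proof -
  show A: "0 \<le> A" and C: "0 \<le> C"
    using form[of 1 0] form[of 0 1] by auto
  show "B\<^sup>2 \<le> A * C"
  proof (cases "A = 0")
    case True
    have "B = 0"
    proof (rule ccontr)
      assume "B \<noteq> 0"
      then show False
        \<comment> \<open>With \<open>A = 0\<close> the form at \<open>(x, 1)\<close> is \<open>2 * B * x + C\<close>, which is \<open>- 1\<close> here.\<close>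
        using form[of "- (C + 1) / (2 * B)" 1] True by (simp add: field_simps)
    qed
    then show ?thesis
      using True by simp
  next
    case False
    have "A * (A * C - B\<^sup>2) \<ge> 0"
      using form[of "- B" A] by (simp add: algebra_simps power2_eq_square)
    then show ?thesis
      using False A by (simp add: zero_le_mult_iff)
  qed
qed

text \<open>The number of atoms is the rank of the matrix.  The cases correspond to the rank of the Schur
  complement \<open>(A, B; B, C)\<close> of the corner entry \<open>1\<close>, that is, of the covariance matrix of the measure to be found:
  one atom if it vanishes, two atoms if it is singular, and otherwise two atoms and the origin.
  Affine independence of the atoms is read off from the covariance, or from the second
  moments when the origin is among them.\<close>

lemma quadratic_moment_problem:
  fixes a b c e d :: real
  assumes pos: "0 < a" "0 < b" "0 < c" "0 < e" "0 < d"
    and psd: "\<And>x0 x1 x2. 0 \<le> x0\<^sup>2 + 2 * a * x0 * x1 + 2 * b * x0 * x2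
                  + c * x1\<^sup>2 + 2 * e * x1 * x2 + d * x2\<^sup>2"
  obtains n w x y where
    "\<And>l. l < n \<Longrightarrow> 0 < w l \<and> 0 \<le> x l \<and> 0 \<le> y l"
    "atomic_moment n w x y (0, 0) = 1"
    "atomic_moment n w x y (0, 1) = a" "atomic_moment n w x y (1, 0) = b"
    "atomic_moment n w x y (0, 2) = c" "atomic_moment n w x y (1, 1) = e"
    "atomic_moment n w x y (2, 0) = d"
    "affinely_interpolating n x y"
proof -
  define A where "A = c - a\<^sup>2"
  define B where "B = e - a * b"
  define C where "C = d - b\<^sup>2"
  have "0 \<le> A * p\<^sup>2 + 2 * B * p * q + C * q\<^sup>2" for p q
    using psd[of "- (a * p + b * q)" p q]
    by (simp add: A_def B_def C_def algebra_simps power2_eq_square)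
  note minors = quadratic_form_minors[OF this]
  consider "A = 0" "C = 0" | "A \<noteq> 0 \<or> C \<noteq> 0" "A * C = B\<^sup>2" | "B\<^sup>2 < A * C"
    using minors by linarith
  then show thesis
  proof cases
    case 1
    then have "B = 0"
      using minors by simp
    then show thesis
      using 1 pos
      by (intro that[of "Suc 0" "\<lambda>_. 1" "\<lambda>_. a" "\<lambda>_. b"] affinely_interpolating_one)
        (auto simp: atomic_moment_def A_def B_def C_def power2_eq_square)
  next
    case 2
    obtain u0 u1 u2 v0 v1 v2 where
      uv: "0 < u0" "0 < u1" "0 < u2" "0 < v0" "0 < v1" "0 < v2" and
      gram: "u0 * u0 + v0 * v0 = 1" "u0 * u1 + v0 * v1 = a" "u0 * u2 + v0 * v2 = b"
      "u1 * u1 + v1 * v1 = c" "u1 * u2 + v1 * v2 = e" "u2 * u2 + v2 * v2 = d"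
      by (rule singular_as_two_squares[of 1 a b c e d])
        (use pos minors 2 in \<open>auto simp: A_def B_def C_def\<close>)
    define w where "w = (\<lambda>l :: nat. if l = 0 then u0\<^sup>2 else v0\<^sup>2)"
    define x where "x = (\<lambda>l :: nat. if l = 0 then u1 / u0 else v1 / v0)"
    define y where "y = (\<lambda>l :: nat. if l = 0 then u2 / u0 else v2 / v0)"
    have sum2: "sum f {..<2} = f 0 + f 1" for f :: "nat \<Rightarrow> real"
      by (simp add: numeral_2_eq_2)
    note simps = w_def x_def y_def atomic_moment_def sum2
    have moms: "atomic_moment 2 w x y (0, 0) = 1"
      "atomic_moment 2 w x y (0, 1) = a" "atomic_moment 2 w x y (1, 0) = b"
      "atomic_moment 2 w x y (0, 2) = c" "atomic_moment 2 w x y (1, 1) = e"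
      "atomic_moment 2 w x y (2, 0) = d"
      using uv gram by (simp_all add: simps power2_eq_square)
    \<comment> \<open>If the atoms coincided, the covariance matrix would vanish.\<close>
    have "x 0 \<noteq> x 1 \<or> y 0 \<noteq> y 1"
    proof (rule ccontr)
      assume "\<not> ?thesis"
      then have eq: "x 0 = x 1" "y 0 = y 1"
        by auto
      have w: "w 0 + w 1 = 1"
        using moms by (simp add: atomic_moment_def sum2)
      have "a = x 1" "b = y 1" "c = x 1 ^ 2" "d = y 1 ^ 2"
        using moms eq w by (auto simp: atomic_moment_def sum2 distrib_right[symmetric])
      then show False
        using 2 by (simp add: A_def C_def)
    qed
    then show thesis
      using uv moms
      by (intro that[of 2 w x y] affinely_interpolating_two) (auto simp: w_def x_def y_def)
  next
    case 3
    have "0 < A" "0 < C"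
      using 3 minors by (auto simp: order_le_less)
    \<comment> \<open>As a function of its corner entry the determinant is affine with slope \<open>D\<close>, and it vanishes
      when the corner entry is \<open>s = E / D\<close>.  At the corner entry \<open>1\<close> it equals \<open>A * C - B\<^sup>2 > 0\<close>,
      so \<open>s < 1\<close>; and \<open>E\<close> is the value of the definite form \<open>(A, B; B, C)\<close> at \<open>(b, - a)\<close>, so \<open>0 < s\<close>.\<close>
    define D where "D = c * d - e\<^sup>2"
    define E where "E = A * b\<^sup>2 - 2 * B * (a * b) + C * a\<^sup>2"
    have "A * E = (A * b - B * a)\<^sup>2 + (A * C - B\<^sup>2) * a\<^sup>2"
      by (simp add: E_def algebra_simps power2_eq_square)
    also have "\<dots> > 0"
      using 3 pos by (intro add_nonneg_pos) auto
    finally have "0 < E"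
      using \<open>0 < A\<close> by (simp add: zero_less_mult_iff)
    have DE: "D = A * C - B\<^sup>2 + E"
      by (simp add: A_def B_def C_def D_def E_def algebra_simps power2_eq_square)
    then have "0 < D"
      using 3 \<open>0 < E\<close> by simp
    define s where "s = E / D"
    have s: "0 < s" "s < 1" "s * D = E"
      using \<open>0 < E\<close> \<open>0 < D\<close> DE 3 by (auto simp: s_def)
    have E: "E = a\<^sup>2 * d - 2 * a * b * e + b\<^sup>2 * c"
      by (simp add: A_def B_def C_def E_def algebra_simps power2_eq_square)
    have "D * (s * c - a\<^sup>2) = (b * c - a * e)\<^sup>2" "D * (s * d - b\<^sup>2) = (a * d - b * e)\<^sup>2"
    proof -
      have "D * (s * c - a\<^sup>2) = E * c - D * a\<^sup>2" "D * (s * d - b\<^sup>2) = E * d - D * b\<^sup>2"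
        by (simp_all add: s(3)[symmetric] algebra_simps)
      then show "D * (s * c - a\<^sup>2) = (b * c - a * e)\<^sup>2" "D * (s * d - b\<^sup>2) = (a * d - b * e)\<^sup>2"
        by (simp_all add: E D_def algebra_simps power2_eq_square)
    qed
    then have "0 \<le> D * (s * c - a\<^sup>2)" "0 \<le> D * (s * d - b\<^sup>2)"
      by simp_all
    then have corner: "a\<^sup>2 \<le> s * c" "b\<^sup>2 \<le> s * d"
      using \<open>0 < D\<close> by (simp_all add: zero_le_mult_iff)
    have "(s * c - a\<^sup>2) * (s * d - b\<^sup>2) - (s * e - a * b)\<^sup>2 = s * (s * D - E)"
      by (simp add: E D_def algebra_simps power2_eq_square)
    then have singular: "(s * c - a\<^sup>2) * (s * d - b\<^sup>2) = (s * e - a * b)\<^sup>2"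
      using s by simp
    obtain u0 u1 u2 v0 v1 v2 where
      uv: "0 < u0" "0 < u1" "0 < u2" "0 < v0" "0 < v1" "0 < v2" and
      gram: "u0 * u0 + v0 * v0 = s" "u0 * u1 + v0 * v1 = a" "u0 * u2 + v0 * v2 = b"
      "u1 * u1 + v1 * v1 = c" "u1 * u2 + v1 * v2 = e" "u2 * u2 + v2 * v2 = d"
      by (rule singular_as_two_squares[OF s(1) pos corner singular])
    define w where "w = (\<lambda>l :: nat. if l = 0 then u0\<^sup>2 else if l = 1 then v0\<^sup>2 else 1 - s)"
    define x where "x = (\<lambda>l :: nat. if l = 0 then u1 / u0 else if l = 1 then v1 / v0 else 0)"
    define y where "y = (\<lambda>l :: nat. if l = 0 then u2 / u0 else if l = 1 then v2 / v0 else 0)"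
    have sum3: "sum f {..<3} = f 0 + f 1 + f 2" for f :: "nat \<Rightarrow> real"
      by (simp add: numeral_3_eq_3 numeral_2_eq_2)
    note simps = w_def x_def y_def atomic_moment_def sum3
    have moms: "atomic_moment 3 w x y (0, 0) = 1"
      "atomic_moment 3 w x y (0, 1) = a" "atomic_moment 3 w x y (1, 0) = b"
      "atomic_moment 3 w x y (0, 2) = c" "atomic_moment 3 w x y (1, 1) = e"
      "atomic_moment 3 w x y (2, 0) = d"
      using uv gram by (simp_all add: simps power2_eq_square)
    have "D = (u1 * v2 - v1 * u2)\<^sup>2"
      unfolding D_def gram(4-6)[symmetric] by (simp add: algebra_simps power2_eq_square)
    then have "u1 * v2 - v1 * u2 \<noteq> 0"
      using \<open>0 < D\<close> by auto
    moreover have "x 0 * y 1 - x 1 * y 0 = (u1 * v2 - v1 * u2) / (u0 * v0)"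
      using uv by (simp add: x_def y_def field_simps)
    ultimately have "x 0 * y 1 - x 1 * y 0 \<noteq> 0"
      using uv by simp
    then show thesis
      using uv moms s
      by (intro that[of 3 w x y] affinely_interpolating_three) (auto simp: w_def x_def y_def)
  qed
qed

section \<open>Moment matrices\<close>

lemma agree_upto_path_weight:
  assumes "agree_upto m \<alpha> \<beta> \<alpha>' \<beta>'" "deg k + length p \<le> m + 1"
  shows "path_weight \<alpha>' \<beta>' k p = path_weight \<alpha> \<beta> k p"
  using assms(2)
proof (induction p arbitrary: k)
  case (Cons s p)
  then have "deg k \<le> m"
    by simp
  then have "\<alpha>' k = \<alpha> k" "\<beta>' k = \<beta> k"
    using assms(1) unfolding agree_upto_def by blast+
  then show ?case
    using Cons.IH[of "k + eps1"] Cons.IH[of "k + eps2"] Cons.prems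
    by (cases s) (simp_all add: deg_def)
qed simp

lemma deg_pair1: "deg (pair1 u) \<le> 1"
  using pair1[of u] by simp

lemma agree_upto_M_quadratic:
  assumes "agree_upto 1 \<alpha> \<beta> \<alpha>' \<beta>'"
  shows "M_quadratic \<alpha>' \<beta>' = M_quadratic \<alpha> \<beta>"
proof -
  have "moment \<alpha>' \<beta>' (pair1 u + pair1 v) = moment \<alpha> \<beta> (pair1 u + pair1 v)" for u v
    unfolding moment_def using deg_pair1[of u] deg_pair1[of v]
    by (intro agree_upto_path_weight[OF assms]) (simp add: deg_def)
  then show ?thesis
    by (simp add: M_quadratic_def)
qed

lemma UNIV_index1: "UNIV = {Index1 (0, 0), Index1 (0, 1), Index1 (1, 0)}"
proof -
  have "{u. deg u \<le> 1} = {(0, 0), (0, 1), (1, 0)}"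
    by (auto simp: deg_def)
  moreover have "UNIV = Index1 ` {u. deg u \<le> 1}"
    using pair1_inverse pair1 by (metis UNIV_eq_I image_eqI)
  ultimately show ?thesis
    by simp
qed

lemma pair1_Index1:
  "pair1 (Index1 (0, 0)) = (0, 0)" "pair1 (Index1 (0, 1)) = (0, 1)" "pair1 (Index1 (1, 0)) = (1, 0)"
  by (simp_all add: Index1_inverse deg_def)

lemma sum_index1:
  "(\<Sum>u\<in>UNIV. f u) = f (Index1 (0, 0)) + f (Index1 (0, 1)) + f (Index1 (1, 0))"
  for f :: "index1 \<Rightarrow> real"
proof -
  have "Index1 (0, 0) \<noteq> Index1 (0, 1)" "Index1 (0, 0) \<noteq> Index1 (1, 0)"
    "Index1 (0, 1) \<noteq> Index1 (1, 0)"
    using pair1_Index1 by (metis prod.inject zero_neq_one)+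
  then show ?thesis
    unfolding UNIV_index1 by (simp add: add.assoc)
qed

text \<open>A matrix of the form \<open>\<Sum>\<^sub>l w\<^sub>l g\<^sub>l g\<^sub>l\<^sup>T\<close> with \<open>w\<^sub>l \<ge> 0\<close> has quadratic form
  \<open>\<Sum>\<^sub>l w\<^sub>l (z \<bullet> g\<^sub>l)\<^sup>2\<close>.  For the localizing matrices, the coordinate of the atom is absorbed into \<open>w\<^sub>l\<close>.\<close>

lemma psd_moment_matrix:
  fixes A :: "real ^ 'i :: finite ^ 'i"
  assumes "\<And>l. l < n \<Longrightarrow> 0 \<le> w l"
    and A: "\<And>u v. A $ u $ v = (\<Sum>l<n. w l * (g l u * g l v))"
  shows "psd A"
proof -
  have "transpose A = A"
    by (simp add: transpose_def vec_eq_iff A mult.commute)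
  moreover have "0 \<le> z \<bullet> (A *v z)" for z
  proof -
    have "z \<bullet> (A *v z) = (\<Sum>u\<in>UNIV. \<Sum>v\<in>UNIV. \<Sum>l<n. z $ u * (w l * (g l u * g l v) * z $ v))"
      by (simp add: inner_vec_def matrix_vector_mult_def A sum_distrib_left sum_distrib_right)
    also have "\<dots> = (\<Sum>l<n. \<Sum>u\<in>UNIV. \<Sum>v\<in>UNIV. z $ u * (w l * (g l u * g l v) * z $ v))"
      by (simp only: sum.swap[of _ UNIV "{..<n}"])
    also have "\<dots> = (\<Sum>l<n. w l * (\<Sum>u\<in>UNIV. z $ u * g l u)\<^sup>2)"
      by (simp add: power2_eq_square sum_product sum_distrib_left algebra_simps)
    also have "\<dots> \<ge> 0"
      using assms(1) by (intro sum_nonneg) auto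
    finally show ?thesis .
  qed
  ultimately show ?thesis
    by (simp add: psd_def)
qed

text \<open>The right-hand side is what becomes of the polynomial \<open>(x0 + x1 X + x2 Y)\<^sup>2\<close> when every monomial
  is replaced by its moment.\<close>

lemma psd_M_quadratic_form:
  assumes "psd (M_quadratic \<alpha> \<beta>)"
  shows "0 \<le> x0\<^sup>2 + 2 * moment \<alpha> \<beta> (0, 1) * x0 * x1 + 2 * moment \<alpha> \<beta> (1, 0) * x0 * x2
    + moment \<alpha> \<beta> (0, 2) * x1\<^sup>2 + 2 * moment \<alpha> \<beta> (1, 1) * x1 * x2 + moment \<alpha> \<beta> (2, 0) * x2\<^sup>2"
proof -
  define z :: "real ^ index1" where
    "z = (\<chi> s. if pair1 s = (0, 0) then x0 else if pair1 s = (0, 1) then x1 else x2)"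
  have "0 \<le> z \<bullet> (M_quadratic \<alpha> \<beta> *v z)"
    using assms by (simp add: psd_def)
  also have "z \<bullet> (M_quadratic \<alpha> \<beta> *v z) = moment \<alpha> \<beta> (0, 0) * x0\<^sup>2
      + 2 * moment \<alpha> \<beta> (0, 1) * x0 * x1 + 2 * moment \<alpha> \<beta> (1, 0) * x0 * x2
      + moment \<alpha> \<beta> (0, 2) * x1\<^sup>2 + 2 * moment \<alpha> \<beta> (1, 1) * x1 * x2 + moment \<alpha> \<beta> (2, 0) * x2\<^sup>2"
    unfolding inner_vec_def matrix_vector_mult_def sum_index1
    by (simp add: z_def M_quadratic_def pair1_Index1 power2_eq_square algebra_simps 
        del: One_nat_def)
  finally show ?thesis
    by (simp add: moment_def)
qed

section \<open>The weights of a finitely atomic measure\<close>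

text \<open>Positivity of the moment \<open>\<gamma>\<^sub>1\<^sub>1\<close> provides an atom with both coordinates positive; this atom
  alone makes every moment positive.\<close>

locale quadrant_measure =
  fixes n :: nat and w x y :: "nat \<Rightarrow> real"
  assumes atoms: "\<And>l. l < n \<Longrightarrow> 0 < w l \<and> 0 \<le> x l \<and> 0 \<le> y l"
    and total_mass: "atomic_moment n w x y (0, 0) = 1"
    and not_on_axes: "0 < atomic_moment n w x y (1, 1)"
begin

abbreviation \<gamma> :: "nat \<times> nat \<Rightarrow> real" where
  "\<gamma> \<equiv> atomic_moment n w x y"

text \<open>A step of a lattice path contributes the square of a weight, so these are the weights that
  multiply one moment into the next.\<close>

definition \<alpha> :: "nat \<times> nat \<Rightarrow> real" where
  "\<alpha> k = sqrt (\<gamma> (snd k, Suc (fst k)) / \<gamma> (snd k, fst k))"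

definition \<beta> :: "nat \<times> nat \<Rightarrow> real" where
  "\<beta> k = sqrt (\<gamma> (Suc (snd k), fst k) / \<gamma> (snd k, fst k))"

lemma moment_pos: "0 < \<gamma> u"
proof -
  have "(\<Sum>l<n. w l * (x l * y l)) \<noteq> 0"
    using not_on_axes by (simp add: atomic_moment_def)
  then obtain l where "l \<in> {..<n}" "w l * (x l * y l) \<noteq> 0"
    by (rule sum.not_neutral_contains_not_neutral)
  then have l: "l < n" "x l \<noteq> 0" "y l \<noteq> 0"
    by auto
  show ?thesis
    unfolding atomic_moment_def
  proof (rule sum_pos2[of _ l])
    show "0 < w l * (x l ^ snd u * y l ^ fst u)"
      using l atoms[of l] by simp
  qed (use l atoms in \<open>auto simp: less_imp_le\<close>)
qed

lemma \<alpha>_pos: "0 < \<alpha> k" and \<beta>_pos: "0 < \<beta> k"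
  by (simp_all add: \<alpha>_def \<beta>_def moment_pos)

lemma commutative_weights: "commutative_family m \<alpha> \<beta>"
proof -
  have "\<beta> (k + eps1) * \<alpha> k = \<alpha> (k + eps2) * \<beta> k" for k
    using moment_pos
    by (cases k) (simp add: \<alpha>_def \<beta>_def real_sqrt_mult[symmetric] less_imp_neq[THEN not_sym])
  then show ?thesis
    by (simp add: commutative_family_def \<alpha>_pos \<beta>_pos)
qed

text \<open>The quotients telescope along any path.\<close>

lemma path_weight_ratio:
  "path_weight \<alpha> \<beta> k p =
     \<gamma> (snd k + count_list p Vertical, fst k + count_list p Horizontal) / \<gamma> (snd k, fst k)"
proof (induction p arbitrary: k)
  case Nil
  then show ?case
    using moment_pos[of "(snd k, fst k)"] by simp
next
  case (Cons s p)
  have sq: "(\<alpha> k)\<^sup>2 = \<gamma> (snd k, Suc (fst k)) / \<gamma> (snd k, fst k)"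
    "(\<beta> k)\<^sup>2 = \<gamma> (Suc (snd k), fst k) / \<gamma> (snd k, fst k)"
    using moment_pos by (simp_all add: \<alpha>_def \<beta>_def less_imp_le)
  have nz: "\<gamma> u \<noteq> 0" for u
    using moment_pos[of u] by simp
  show ?case
    by (cases s; cases k) (use sq in \<open>simp_all add: Cons.IH nz\<close>)
qed

lemma moment_eq: "moment \<alpha> \<beta> u = \<gamma> u"
proof -
  have "count_list (replicate m s) t = (if s = t then m else 0)" for m and s t :: step
    by (induction m) auto
  then show ?thesis
    by (simp add: moment_def path_weight_ratio total_mass)
qed

lemma moment_add: "\<gamma> (u + v + t) =
    (\<Sum>l<n. w l * (x l ^ snd t * y l ^ fst t) *
       ((x l ^ snd u * y l ^ fst u) * (x l ^ snd v * y l ^ fst v)))"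
  by (simp add: atomic_moment_def power_add algebra_simps)

lemma psd_localizing: "psd (M_x \<alpha> \<beta>)" "psd (M_y \<alpha> \<beta>)"
proof -
  show "psd (M_x \<alpha> \<beta>)"
    by (rule psd_moment_matrix[where n = n and w = "\<lambda>l. w l * (x l ^ snd (0, 1) * y l ^ fst (0, 1))"
          and g = "\<lambda>l u. x l ^ snd (pair1 u) * y l ^ fst (pair1 u)"])
      (use atoms in \<open>auto simp: M_x_def moment_eq moment_add less_imp_le\<close>)
  show "psd (M_y \<alpha> \<beta>)"
    by (rule psd_moment_matrix[where n = n and w = "\<lambda>l. w l * (x l ^ snd (1, 0) * y l ^ fst (1, 0))"
          and g = "\<lambda>l u. x l ^ snd (pair1 u) * y l ^ fst (pair1 u)"])
      (use atoms in \<open>auto simp: M_y_def moment_eq moment_add less_imp_le\<close>)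
qed

text \<open>The matrix \<open>W\<close> collects the coefficients of affine functions that agree with the monomials of degree at
  most two on the atoms.  It recovers the large matrix from the small one, whereas the
  coordinate selection \<open>P\<close> recovers the small one from the large one.\<close>

lemma rank_M_quartic:
  assumes "affinely_interpolating n x y"
  shows "rank (M_quartic \<alpha> \<beta>) = rank (M_quadratic \<alpha> \<beta>)"
proof -
  let ?g = "\<lambda>l u. x l ^ snd u * y l ^ fst u"
  have M1: "M_quadratic \<alpha> \<beta> $ u $ v = (\<Sum>l<n. w l * (?g l (pair1 u) * ?g l (pair1 v)))" for u v
    by (simp add: M_quadratic_def moment_eq atomic_moment_def power_add algebra_simps)
  have M2: "M_quartic \<alpha> \<beta> $ u $ v = (\<Sum>l<n. w l * (?g l (pair2 u) * ?g l (pair2 v)))" for u v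
    by (simp add: M_quartic_def moment_eq atomic_moment_def power_add algebra_simps)
  have "\<exists>c. \<forall>l<n. ?g l (pair2 u) = (\<Sum>s\<in>UNIV. c s * ?g l (pair1 s))" for u
  proof -
    obtain c0 c1 c2 where c: "\<forall>l<n. ?g l (pair2 u) = c0 + c1 * x l + c2 * y l"
      using assms[unfolded affinely_interpolating_def, THEN spec, of "\<lambda>l. ?g l (pair2 u)"]
      by blast
    show ?thesis
      using c by (intro exI[of _ "\<lambda>s. if pair1 s = (0, 0) then c0
          else if pair1 s = (0, 1) then c1 else c2"]) (simp add: sum_index1 pair1_Index1 del: One_nat_def)
  qed
  then obtain c where c: "\<And>u l. l < n \<Longrightarrow> ?g l (pair2 u) = (\<Sum>s\<in>UNIV. c u s * ?g l (pair1 s))"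
    by metis
  define W :: "real ^ index1 ^ index2" where "W = (\<chi> u s. c u s)"
  have "M_quartic \<alpha> \<beta> = W ** M_quadratic \<alpha> \<beta> ** transpose W"
  proof -
    have "M_quartic \<alpha> \<beta> $ u $ v = (W ** M_quadratic \<alpha> \<beta> ** transpose W) $ u $ v" for u v
    proof -
      have "M_quartic \<alpha> \<beta> $ u $ v = (\<Sum>l<n. w l *
          ((\<Sum>s\<in>UNIV. c u s * ?g l (pair1 s)) * (\<Sum>t\<in>UNIV. c v t * ?g l (pair1 t))))"
        by (simp add: M2 c)
      also have "\<dots> = (\<Sum>l<n. \<Sum>t\<in>UNIV. \<Sum>s\<in>UNIV.
          c u s * (w l * (?g l (pair1 s) * ?g l (pair1 t))) * c v t)"
        by (subst sum_product, subst sum.swap) (simp add: sum_distrib_left algebra_simps)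
      also have "\<dots> = (\<Sum>t\<in>UNIV. \<Sum>s\<in>UNIV. \<Sum>l<n.
          c u s * (w l * (?g l (pair1 s) * ?g l (pair1 t))) * c v t)"
        by (simp only: sum.swap[of _ UNIV "{..<n}"])
      also have "\<dots> = (W ** M_quadratic \<alpha> \<beta> ** transpose W) $ u $ v"
        by (simp add: matrix_matrix_mult_def transpose_def W_def M1 sum_distrib_left sum_distrib_right)
      finally show ?thesis .
    qed
    then show ?thesis
      by (simp add: vec_eq_iff)
  qed
  then have le: "rank (M_quartic \<alpha> \<beta>) \<le> rank (M_quadratic \<alpha> \<beta>)"
    using rank_mul_le_left rank_mul_le_right by (metis order_trans)
  define i where "i = (\<lambda>s. Index2 (pair1 s))"
  have i: "pair2 (i s) = pair1 s" for s
    unfolding i_def using deg_pair1[of s] by (intro Index2_inverse) simp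
  define P :: "real ^ index2 ^ index1" where "P = (\<chi> s u. if u = i s then 1 else 0)"
  have "M_quadratic \<alpha> \<beta> = P ** M_quartic \<alpha> \<beta> ** transpose P"
    by (simp add: vec_eq_iff matrix_matrix_mult_def transpose_def P_def M1 M2 i
        if_distrib[of "\<lambda>z. z * _"] if_distrib[of "\<lambda>z. _ * z"] cong: if_cong)
  then have "rank (M_quadratic \<alpha> \<beta>) \<le> rank (M_quartic \<alpha> \<beta>)"
    using rank_mul_le_left rank_mul_le_right by (metis order_trans)
  with le show ?thesis
    by simp
qed

text \<open>A family with \<open>|k| \<le> 1\<close> is determined by its five moments of degree one and two; at \<open>(0, 1)\<close> this
  needs commutativity, because \<open>moment\<close> computes \<open>\<gamma>\<^sub>1\<^sub>1\<close> through \<open>(1, 0)\<close>.\<close>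

lemma agree_upto_weights:
  assumes "commutative_family 1 a b"
    and "\<gamma> (0, 1) = moment a b (0, 1)" "\<gamma> (1, 0) = moment a b (1, 0)"
    "\<gamma> (0, 2) = moment a b (0, 2)" "\<gamma> (1, 1) = moment a b (1, 1)" "\<gamma> (2, 0) = moment a b (2, 0)"
  shows "agree_upto 1 a b \<alpha> \<beta>"
proof -
  have pos: "0 < a k" "0 < b k" if "deg k \<le> 1" for k
    using assms(1) that unfolding commutative_family_def by blast+
  note pos = pos[of "(0, 0)", simplified deg_def, simplified] pos[of "(1, 0)", simplified deg_def, simplified]
    pos[of "(0, 1)", simplified deg_def, simplified]
  have "b (1, 0) * a (0, 0) = a (0, 1) * b (0, 0)"
    using assms(1) by (auto simp: commutative_family_def deg_def dest: spec[of _ "(0, 0)"])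
  then have comm: "(a (0, 0))\<^sup>2 * (b (1, 0))\<^sup>2 = (b (0, 0))\<^sup>2 * (a (0, 1))\<^sup>2"
    by (metis mult.commute power_mult_distrib)
  have moms: "\<gamma> (0, 1) = (a (0, 0))\<^sup>2" "\<gamma> (1, 0) = (b (0, 0))\<^sup>2"
    "\<gamma> (0, 2) = (a (0, 0))\<^sup>2 * (a (1, 0))\<^sup>2" "\<gamma> (1, 1) = (a (0, 0))\<^sup>2 * (b (1, 0))\<^sup>2"
    "\<gamma> (2, 0) = (b (0, 0))\<^sup>2 * (b (0, 1))\<^sup>2"
    unfolding assms by (simp_all add: moment_def numeral_2_eq_2)
  have "k \<in> {(0, 0), (1, 0), (0, 1)}" if "deg k \<le> 1" for k
    using that by (cases k) (auto simp: deg_def)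
  moreover have "\<alpha> (0, 0) = a (0, 0)" "\<beta> (0, 0) = b (0, 0)"
    using pos moms by (simp_all add: \<alpha>_def \<beta>_def total_mass)
  moreover have "\<alpha> (1, 0) = a (1, 0)" "\<beta> (1, 0) = b (1, 0)"
    using pos moms by (simp_all add: \<alpha>_def \<beta>_def numeral_2_eq_2)
  moreover have "\<alpha> (0, 1) = a (0, 1)" "\<beta> (0, 1) = b (0, 1)"
    using pos moms comm by (simp_all add: \<alpha>_def \<beta>_def numeral_2_eq_2)
  ultimately show ?thesis
    unfolding agree_upto_def by blast
qed

end

section \<open>Weighted pullbacks on square-summable families\<close>

text \<open>A common form for all operators that occur: the weighted shifts, the normal operators, and the
  isometry between them.  Pulling back along \<open>\<sigma>\<close> moves the basis vector at \<open>i\<close> to the fibre of \<open>\<sigma>\<close>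
  over \<open>i\<close>, with coefficients \<open>c\<close>.\<close>

definition weighted_pullback ::
    "('j \<Rightarrow> real) \<Rightarrow> ('j \<Rightarrow> 'i) \<Rightarrow> ('i \<Rightarrow> complex) \<Rightarrow> 'j \<Rightarrow> complex" where
  "weighted_pullback c \<sigma> f = (\<lambda>j. complex_of_real (c j) * f (\<sigma> j))"

text \<open>The images of distinct basis vectors have disjoint supports, so the operator is bounded as soon as
  these images are uniformly bounded.\<close>

lemma bounded_op_weighted_pullback:
  assumes C: "\<And>F i. finite F \<Longrightarrow> (\<Sum>j\<in>{j \<in> F. \<sigma> j = i}. (c j)\<^sup>2) \<le> C"
  shows "bounded_op (weighted_pullback c \<sigma>)"
proof -
  let ?W = "weighted_pullback c \<sigma>"
  have C0: "0 \<le> C"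
    using C[of "{}"] by simp
  have finite_bound: "(\<Sum>j\<in>F. (cmod (?W f j))\<^sup>2) \<le> C * (\<Sum>\<^sub>\<infinity>i. (cmod (f i))\<^sup>2)"
    if "f \<in> ell2" "finite F" for f F
  proof -
    have "(\<Sum>j\<in>F. (cmod (?W f j))\<^sup>2) = (\<Sum>j\<in>F. (c j)\<^sup>2 * (cmod (f (\<sigma> j)))\<^sup>2)"
      by (simp add: weighted_pullback_def norm_mult power_mult_distrib)
    also have "\<dots> = (\<Sum>i\<in>\<sigma> ` F. \<Sum>j\<in>{j \<in> F. \<sigma> j = i}. (c j)\<^sup>2 * (cmod (f (\<sigma> j)))\<^sup>2)"
      by (rule sum.image_gen[OF \<open>finite F\<close>])
    also have "\<dots> = (\<Sum>i\<in>\<sigma> ` F. (\<Sum>j\<in>{j \<in> F. \<sigma> j = i}. (c j)\<^sup>2) * (cmod (f i))\<^sup>2)"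
      by (simp add: sum_distrib_right)
    also have "\<dots> \<le> (\<Sum>i\<in>\<sigma> ` F. C * (cmod (f i))\<^sup>2)"
      using C \<open>finite F\<close> by (intro sum_mono mult_right_mono) auto
    also have "\<dots> \<le> C * (\<Sum>\<^sub>\<infinity>i. (cmod (f i))\<^sup>2)"
      using C0 that unfolding sum_distrib_left[symmetric]
      by (intro mult_left_mono finite_sum_le_infsum) (auto simp: ell2_def)
    finally show ?thesis .
  qed
  have ell2: "?W f \<in> ell2" if "f \<in> ell2" for f
    unfolding ell2_def mem_Collect_eq
  proof (rule nonneg_bdd_above_summable_on)
    show "bdd_above (sum (\<lambda>j. (cmod (?W f j))\<^sup>2) ` {F. F \<subseteq> UNIV \<and> finite F})"
      using finite_bound[OF that] by (auto intro!: bdd_aboveI)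
  qed simp
  have "ell2_norm (?W f) \<le> sqrt C * ell2_norm f" if "f \<in> ell2" for f
    unfolding ell2_norm_def real_sqrt_mult[symmetric]
    using ell2[OF that] finite_bound[OF that]
    by (intro real_sqrt_le_mono infsum_le_finite_sums) (auto simp: ell2_def)
  then show ?thesis
    unfolding bounded_op_def using ell2
    by (intro conjI exI[of _ "sqrt C"]) (simp_all add: weighted_pullback_def algebra_simps)
qed

lemma bounded_op_weighted_pullback_inj:
  fixes \<sigma> :: "'j \<Rightarrow> 'i"
  assumes inj: "inj_on \<sigma> {j. c j \<noteq> 0}" and C: "\<And>j. \<bar>c j\<bar> \<le> C"
  shows "bounded_op (weighted_pullback c \<sigma>)"
proof (rule bounded_op_weighted_pullback)
  fix F :: "'j set" and i
  assume "finite F"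
  show "(\<Sum>j\<in>{j \<in> F. \<sigma> j = i}. (c j)\<^sup>2) \<le> C\<^sup>2"
  proof (cases "\<exists>j\<in>F. \<sigma> j = i \<and> c j \<noteq> 0")
    case True
    then obtain j where j: "j \<in> F" "\<sigma> j = i" "c j \<noteq> 0"
      by blast
    then have "(\<Sum>j\<in>{j \<in> F. \<sigma> j = i}. (c j)\<^sup>2) = (\<Sum>j\<in>{j}. (c j)\<^sup>2)"
      using inj \<open>finite F\<close> by (intro sum.mono_neutral_right) (auto simp: inj_on_def)
    also have "\<dots> \<le> C\<^sup>2"
      using C[of j] by (simp add: abs_le_square_iff[symmetric])
    finally show ?thesis .
  next
    case False
    then have "(\<Sum>j\<in>{j \<in> F. \<sigma> j = i}. (c j)\<^sup>2) = 0"
      by (intro sum.neutral) auto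
    then show ?thesis
      by simp
  qed
qed

text \<open>For a bijection the adjoint pulls back along the inverse, with weights that are unchanged since
  \<open>c\<close> is constant on the orbits of \<open>\<sigma>\<close>; both products are then multiplication by \<open>c\<^sup>2\<close>.\<close>

lemma normal_op_weighted_pullback:
  assumes "bij \<sigma>" and C: "\<And>j. \<bar>c j\<bar> \<le> C" and invariant: "\<And>j. c (\<sigma> j) = c j"
  shows "normal_op (weighted_pullback c \<sigma>)"
proof -
  have inv: "\<sigma> (inv \<sigma> j) = j" "inv \<sigma> (\<sigma> j) = j" for j
    using \<open>bij \<sigma>\<close> by (simp_all add: bij_is_surj bij_is_inj surj_f_inv_f)
  have invariant': "c (inv \<sigma> j) = c j" for j
    using invariant[of "inv \<sigma> j"] by (simp add: inv)
  have bounded: "bounded_op (weighted_pullback c \<sigma>)" "bounded_op (weighted_pullback c (inv \<sigma>))"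
    using \<open>bij \<sigma>\<close> bij_imp_bij_inv[OF \<open>bij \<sigma>\<close>]
    by (auto intro!: bounded_op_weighted_pullback_inj[OF _ C] intro: inj_on_subset[OF bij_is_inj])
  have "ell2_inner (weighted_pullback c \<sigma> f) g = ell2_inner f (weighted_pullback c (inv \<sigma>) g)" for f g
  proof -
    have "ell2_inner (weighted_pullback c \<sigma> f) g
        = (\<Sum>\<^sub>\<infinity>j. f (\<sigma> j) * cnj (weighted_pullback c (inv \<sigma>) g (\<sigma> j)))"
      by (simp add: ell2_inner_def weighted_pullback_def inv invariant algebra_simps)
    also have "\<dots> = ell2_inner f (weighted_pullback c (inv \<sigma>) g)"
      unfolding ell2_inner_def by (rule infsum_reindex_bij_betw[OF \<open>bij \<sigma>\<close>])
    finally show ?thesis .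
  qed
  then have "adjoint_of (weighted_pullback c (inv \<sigma>)) (weighted_pullback c \<sigma>)"
    using bounded by (simp add: adjoint_of_def)
  moreover have "weighted_pullback c \<sigma> (weighted_pullback c (inv \<sigma>) f)
      = weighted_pullback c (inv \<sigma>) (weighted_pullback c \<sigma> f)" for f
    by (simp add: weighted_pullback_def inv invariant invariant')
  ultimately show ?thesis
    using bounded by (auto simp: normal_op_def)
qed

lemma ell2_product_summable:
  assumes "f \<in> ell2" "g \<in> ell2"
  shows "(\<lambda>i. f i * cnj (g i)) summable_on UNIV"
proof -
  have "(\<lambda>i. norm (f i * f i)) summable_on UNIV"
    "(\<lambda>i. norm (cnj (g i) * cnj (g i))) summable_on UNIV"
    using assms by (simp_all add: ell2_def norm_mult power2_eq_square)
  then show ?thesis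
    by (rule abs_summable_summable[OF abs_summable_product])
qed

text \<open>Summing first over the fibres reduces the inner product of the images to the original one,
  because each basis vector is sent to a unit vector.  The finite set \<open>G i\<close> is the part of the fibre over
  \<open>i\<close> on which \<open>c\<close> may be nonzero.\<close>

lemma isometric_op_weighted_pullback:
  fixes \<sigma> :: "'j \<Rightarrow> 'i"
  assumes finite: "\<And>i. finite (G i)"
    and support: "\<And>j. c j \<noteq> 0 \<Longrightarrow> j \<in> G (\<sigma> j)"
    and fibre: "\<And>i j. j \<in> G i \<Longrightarrow> \<sigma> j = i"
    and one: "\<And>i. (\<Sum>j\<in>G i. (c j)\<^sup>2) = 1"
  shows "isometric_op (weighted_pullback c \<sigma>)"
proof -
  let ?W = "weighted_pullback c \<sigma>"
  have bounded: "bounded_op ?W"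
  proof (rule bounded_op_weighted_pullback)
    fix F :: "'j set" and i
    assume "finite F"
    then have "(\<Sum>j\<in>{j \<in> F. \<sigma> j = i}. (c j)\<^sup>2) = (\<Sum>j\<in>{j \<in> F. \<sigma> j = i \<and> c j \<noteq> 0}. (c j)\<^sup>2)"
      by (intro sum.mono_neutral_right) auto
    also have "\<dots> \<le> (\<Sum>j\<in>G i. (c j)\<^sup>2)"
      using support finite by (intro sum_mono2) auto
    finally show "(\<Sum>j\<in>{j \<in> F. \<sigma> j = i}. (c j)\<^sup>2) \<le> 1"
      using one by simp
  qed
  have "ell2_inner (?W f) (?W g) = ell2_inner f g" if "f \<in> ell2" "g \<in> ell2" for f g
  proof -
    define h where "h j = ?W f j * cnj (?W g j)" for j
    have h: "h j = of_real ((c j)\<^sup>2) * (f (\<sigma> j) * cnj (g (\<sigma> j)))" for j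
      by (simp add: h_def weighted_pullback_def power2_eq_square)
    have "h summable_on UNIV"
      using ell2_product_summable[of "?W f" "?W g"] bounded that
      by (simp add: h_def[abs_def] bounded_op_def)
    then have "h summable_on (\<Union>i. G i)"
      using summable_on_subset_banach by blast
    moreover have bij: "bij_betw snd (Sigma UNIV G) (\<Union>i. G i)"
    proof (rule bij_betwI[where g = "\<lambda>j. (\<sigma> j, j)"])
      show "(\<lambda>j. (\<sigma> j, j)) \<in> (\<Union>i. G i) \<rightarrow> Sigma UNIV G"
        by (auto simp: fibre)
    qed (use fibre in auto)
    ultimately have summable: "(\<lambda>p. h (snd p)) summable_on Sigma UNIV G"
      using summable_on_reindex_bij_betw[OF bij, of h] by simp
    have "ell2_inner (?W f) (?W g) = infsum h UNIV"
      by (simp add: ell2_inner_def h_def[abs_def])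
    also have "\<dots> = infsum h (\<Union>i. G i)"
      using support by (intro infsum_cong_neutral) (auto simp: h)
    also have "\<dots> = (\<Sum>\<^sub>\<infinity>p\<in>Sigma UNIV G. h (snd p))"
      using infsum_reindex_bij_betw[OF bij, of h] by simp
    also have "\<dots> = (\<Sum>\<^sub>\<infinity>i. \<Sum>\<^sub>\<infinity>j\<in>G i. h j)"
      using infsum_Sigma_banach[OF summable] by simp
    also have "\<dots> = (\<Sum>\<^sub>\<infinity>i. \<Sum>j\<in>G i. h j)"
      using finite by simp
    also have "\<dots> = (\<Sum>\<^sub>\<infinity>i. f i * cnj (g i))"
    proof (rule infsum_cong)
      fix i
      have "(\<Sum>j\<in>G i. h j) = (\<Sum>j\<in>G i. of_real ((c j)\<^sup>2) * (f i * cnj (g i)))"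
        using fibre by (intro sum.cong) (auto simp: h)
      also have "\<dots> = of_real (\<Sum>j\<in>G i. (c j)\<^sup>2) * (f i * cnj (g i))"
        by (simp add: sum_distrib_right)
      finally show "(\<Sum>j\<in>G i. h j) = f i * cnj (g i)"
        by (simp add: one)
    qed
    finally show ?thesis
      by (simp add: ell2_inner_def)
  qed
  then show ?thesis
    using bounded by (simp add: isometric_op_def)
qed

section \<open>The subnormal weighted shift of a finitely atomic measure\<close>

context quadrant_measure
begin

text \<open>Raising an exponent multiplies the integrand by a coordinate, which is at most the sum of the
  coordinates of all atoms.\<close>

lemma weights_bounded: "bounded (range \<alpha>)" "bounded (range \<beta>)"
proof -
  have sum: "f l \<le> (\<Sum>l<n. f l)" if "\<And>l. l < n \<Longrightarrow> 0 \<le> f l" "l < n" for f :: "nat \<Rightarrow> real" and l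
    using that by (intro member_le_sum) auto
  have "\<gamma> (j, Suc i) \<le> (\<Sum>l<n. x l) * \<gamma> (j, i)" for i j
  proof -
    have "\<gamma> (j, Suc i) = (\<Sum>l<n. x l * (w l * (x l ^ i * y l ^ j)))"
      by (simp add: atomic_moment_def algebra_simps)
    also have "\<dots> \<le> (\<Sum>l<n. (\<Sum>l<n. x l) * (w l * (x l ^ i * y l ^ j)))"
      using atoms by (intro sum_mono mult_right_mono sum) (auto simp: less_imp_le)
    finally show ?thesis
      by (simp add: atomic_moment_def sum_distrib_left)
  qed
  then have a: "\<bar>\<alpha> k\<bar> \<le> sqrt (\<Sum>l<n. x l)" for k
    using moment_pos by (simp add: \<alpha>_def divide_le_eq less_imp_le)
  have "\<gamma> (Suc j, i) \<le> (\<Sum>l<n. y l) * \<gamma> (j, i)" for i j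
  proof -
    have "\<gamma> (Suc j, i) = (\<Sum>l<n. y l * (w l * (x l ^ i * y l ^ j)))"
      by (simp add: atomic_moment_def algebra_simps)
    also have "\<dots> \<le> (\<Sum>l<n. (\<Sum>l<n. y l) * (w l * (x l ^ i * y l ^ j)))"
      using atoms by (intro sum_mono mult_right_mono sum) (auto simp: less_imp_le)
    finally show ?thesis
      by (simp add: atomic_moment_def sum_distrib_left)
  qed
  then have b: "\<bar>\<beta> k\<bar> \<le> sqrt (\<Sum>l<n. y l)" for k
    using moment_pos by (simp add: \<beta>_def divide_le_eq less_imp_le)
  show "bounded (range \<alpha>)" "bounded (range \<beta>)"
    using a b by (auto simp: bounded_iff)
qed

definition T1 :: "(nat \<times> nat \<Rightarrow> complex) \<Rightarrow> nat \<times> nat \<Rightarrow> complex" where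
  "T1 = weighted_pullback (\<lambda>(i, j). if i = 0 then 0 else \<alpha> (i - 1, j)) (\<lambda>(i, j). (i - 1, j))"

definition T2 :: "(nat \<times> nat \<Rightarrow> complex) \<Rightarrow> nat \<times> nat \<Rightarrow> complex" where
  "T2 = weighted_pullback (\<lambda>(i, j). if j = 0 then 0 else \<beta> (i, j - 1)) (\<lambda>(i, j). (i, j - 1))"

lemma weighted_shift_T: "weighted_shift \<alpha> \<beta> T1 T2"
proof -
  obtain C where C: "\<And>k. \<bar>\<alpha> k\<bar> \<le> C"
    using weights_bounded(1) by (auto simp: bounded_iff)
  have "bounded_op T1"
    unfolding T1_def
    by (rule bounded_op_weighted_pullback_inj[where C = C])
      (use C order_trans[OF abs_ge_zero C] in \<open>auto simp: inj_on_def split: if_splits\<close>)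
  moreover obtain C' where C': "\<And>k. \<bar>\<beta> k\<bar> \<le> C'"
    using weights_bounded(2) by (auto simp: bounded_iff)
  have "bounded_op T2"
    unfolding T2_def
    by (rule bounded_op_weighted_pullback_inj[where C = C'])
      (use C' order_trans[OF abs_ge_zero C'] in \<open>auto simp: inj_on_def split: if_splits\<close>)
  moreover have "T1 (basis_vec k) = (\<lambda>i. complex_of_real (\<alpha> k) * basis_vec (k + eps1) i)"
    "T2 (basis_vec k) = (\<lambda>i. complex_of_real (\<beta> k) * basis_vec (k + eps2) i)" for k
    by (cases k; auto simp: T1_def T2_def weighted_pullback_def basis_vec_def fun_eq_iff)+
  ultimately show ?thesis
    using weights_bounded by (simp add: weighted_shift_def \<alpha>_pos \<beta>_pos)
qed

text \<open>The coefficient of the image of the basis vector \<open>e\<^sub>k\<close> on the torus that belongs to the \<open>l\<close>-th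
  atom.\<close>

definition embedding_coeff :: "nat \<times> nat \<Rightarrow> nat \<Rightarrow> real" where
  "embedding_coeff k l = sqrt (w l * (x l ^ fst k * y l ^ snd k) / \<gamma> (snd k, fst k))"

text \<open>This is the restriction property of the normal operators, read off one coefficient at a time.\<close>

lemma embedding_coeff_intertwines:
  shows "sqrt (x l) * embedding_coeff (i, j) l = embedding_coeff (Suc i, j) l * \<alpha> (i, j)"
    and "sqrt (y l) * embedding_coeff (i, j) l = embedding_coeff (i, Suc j) l * \<beta> (i, j)"
  using moment_pos[of "(j, Suc i)"] moment_pos[of "(Suc j, i)"]
  by (simp_all add: embedding_coeff_def \<alpha>_def \<beta>_def real_sqrt_mult[symmetric] algebra_simps)

lemma embedding_coeff_unit: "(\<Sum>l<n. (embedding_coeff k l)\<^sup>2) = 1"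
proof -
  have "(embedding_coeff k l)\<^sup>2 = w l * (x l ^ fst k * y l ^ snd k) / \<gamma> (snd k, fst k)" if "l < n" for l
    using atoms[OF that] moment_pos[of "(snd k, fst k)"]
    by (simp add: embedding_coeff_def less_imp_le)
  then have "(\<Sum>l<n. (embedding_coeff k l)\<^sup>2) = \<gamma> (snd k, fst k) / \<gamma> (snd k, fst k)"
    by (subst (1) atomic_moment_def) (simp add: sum_divide_distrib)
  then show ?thesis
    using moment_pos[of "(snd k, fst k)"] by simp
qed

text \<open>The larger space is \<open>\<ell>\<^sup>2\<close> over \<open>\<int>\<^sup>2 \<times> \<nat>\<close>, carried over to \<open>\<nat>\<close> by a bijection \<open>\<phi>\<close>.  The third component
  is the number of an atom; the normal operators vanish on the components beyond the last atom, which
  are there only to make the index set a fixed countable one.\<close>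

lemma subnormal_T: "subnormal_pair T1 T2"
proof -
  obtain \<phi> :: "nat \<Rightarrow> int \<times> int \<times> nat" where "bij \<phi>"
  proof -
    have "infinite (UNIV :: (int \<times> int \<times> nat) set)"
      by (simp add: finite_prod)
    then show thesis
      using that bij_betw_from_nat_into[of "UNIV :: (int \<times> int \<times> nat) set"] by simp
  qed
  define \<psi> where "\<psi> = inv \<phi>"
  have \<phi>\<psi>: "\<phi> (\<psi> t) = t" "\<psi> (\<phi> m) = m" for t m
    using \<open>bij \<phi>\<close> by (simp_all add: \<psi>_def bij_is_surj bij_is_inj surj_f_inv_f)
  define s1 :: "int \<times> int \<times> nat \<Rightarrow> int \<times> int \<times> nat" where "s1 = (\<lambda>(p, q, l). (p - 1, q, l))"
  define s2 :: "int \<times> int \<times> nat \<Rightarrow> int \<times> int \<times> nat" where "s2 = (\<lambda>(p, q, l). (p, q - 1, l))"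
  define c1 where "c1 = (\<lambda>(p :: int, q :: int, l). if l < n then sqrt (x l) else 0)"
  define c2 where "c2 = (\<lambda>(p :: int, q :: int, l). if l < n then sqrt (y l) else 0)"
  define d where "d = (\<lambda>(p :: int, q :: int, l).
    if 0 \<le> p \<and> 0 \<le> q \<and> l < n then embedding_coeff (nat p, nat q) l else 0)"
  define t where "t = (\<lambda>(p :: int, q :: int, l :: nat). (nat p, nat q))"
  define N1 where "N1 = weighted_pullback (c1 \<circ> \<phi>) (\<psi> \<circ> s1 \<circ> \<phi>)"
  define N2 where "N2 = weighted_pullback (c2 \<circ> \<phi>) (\<psi> \<circ> s2 \<circ> \<phi>)"
  define U where "U = weighted_pullback (d \<circ> \<phi>) (t \<circ> \<phi>)"
  have bij: "bij (\<psi> \<circ> s1 \<circ> \<phi>)" "bij (\<psi> \<circ> s2 \<circ> \<phi>)"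
  proof -
    have "bij s1"
      by (rule bij_betw_byWitness[where f' = "\<lambda>(p, q, l). (p + 1, q, l)"]) (auto simp: s1_def)
    moreover have "bij s2"
      by (rule bij_betw_byWitness[where f' = "\<lambda>(p, q, l). (p, q + 1, l)"]) (auto simp: s2_def)
    ultimately show "bij (\<psi> \<circ> s1 \<circ> \<phi>)" "bij (\<psi> \<circ> s2 \<circ> \<phi>)"
      using \<open>bij \<phi>\<close> bij_imp_bij_inv[OF \<open>bij \<phi>\<close>] unfolding \<psi>_def by (blast intro: bij_comp)+
  qed
  have le: "f l \<le> (\<Sum>l<n. f l)" if "\<And>l. l < n \<Longrightarrow> 0 \<le> f l" "l < n" for f :: "nat \<Rightarrow> real" and l
    using that by (intro member_le_sum) auto
  have "normal_op N1"
    unfolding N1_def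
  proof (rule normal_op_weighted_pullback[OF bij(1), where C = "\<Sum>l<n. sqrt (x l)"])
    show "\<bar>(c1 \<circ> \<phi>) m\<bar> \<le> (\<Sum>l<n. sqrt (x l))" for m
      using atoms le[of "\<lambda>l. sqrt (x l)"]
      by (cases "\<phi> m") (auto simp: c1_def intro!: sum_nonneg)
  qed (auto simp: \<phi>\<psi> c1_def s1_def split: prod.splits)
  moreover have "normal_op N2"
    unfolding N2_def
  proof (rule normal_op_weighted_pullback[OF bij(2), where C = "\<Sum>l<n. sqrt (y l)"])
    show "\<bar>(c2 \<circ> \<phi>) m\<bar> \<le> (\<Sum>l<n. sqrt (y l))" for m
      using atoms le[of "\<lambda>l. sqrt (y l)"]
      by (cases "\<phi> m") (auto simp: c2_def intro!: sum_nonneg)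
  qed (auto simp: \<phi>\<psi> c2_def s2_def split: prod.splits)
  moreover have "N1 (N2 f) = N2 (N1 f)" for f
    by (auto simp: N1_def N2_def weighted_pullback_def \<phi>\<psi> c1_def c2_def s1_def s2_def
        split: prod.splits)
  moreover have "isometric_op U"
    unfolding U_def
  proof (rule isometric_op_weighted_pullback
      [where G = "\<lambda>k. (\<lambda>l. \<psi> (int (fst k), int (snd k), l)) ` {..<n}"])
    show "m \<in> (\<lambda>l. \<psi> (int (fst ((t \<circ> \<phi>) m)), int (snd ((t \<circ> \<phi>) m)), l)) ` {..<n}"
      if "(d \<circ> \<phi>) m \<noteq> 0" for m
    proof -
      obtain p q l where m: "\<phi> m = (p, q, l)"
        by (cases "\<phi> m")
      then have "0 \<le> p" "0 \<le> q" "l < n"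
        using that by (auto simp: d_def split: if_splits)
      then show ?thesis
        using m \<phi>\<psi>(2)[of m] by (auto simp: t_def)
    qed
    show "(t \<circ> \<phi>) m = k" if "m \<in> (\<lambda>l. \<psi> (int (fst k), int (snd k), l)) ` {..<n}" for k m
      using that by (auto simp: t_def \<phi>\<psi>)
    show "(\<Sum>m\<in>(\<lambda>l. \<psi> (int (fst k), int (snd k), l)) ` {..<n}. ((d \<circ> \<phi>) m)\<^sup>2) = 1" for k
    proof -
      have "inj_on (\<lambda>l. \<psi> (int (fst k), int (snd k), l)) {..<n}"
        by (rule inj_onI) (metis \<phi>\<psi>(1) prod.inject)
      then have "(\<Sum>m\<in>(\<lambda>l. \<psi> (int (fst k), int (snd k), l)) ` {..<n}. ((d \<circ> \<phi>) m)\<^sup>2) = (\<Sum>l<n. (embedding_coeff k l)\<^sup>2)"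
        by (simp add: sum.reindex \<phi>\<psi> d_def)
      then show ?thesis
        by (simp add: embedding_coeff_unit)
    qed
  qed simp
  moreover have NU: "N1 (U f) = U (T1 f)" "N2 (U f) = U (T2 f)" for f
  proof -
    show "N1 (U f) = U (T1 f)"
    proof
      fix m
      obtain p q l where m: "\<phi> m = (p, q, l)"
        by (cases "\<phi> m")
      \<comment> \<open>Both sides vanish unless the index lies in the image of the quadrant under the shift.\<close>
      show "N1 (U f) m = U (T1 f) m"
      proof (cases "0 < p \<and> 0 \<le> q \<and> l < n")
        case True
        then obtain i j where "p = int (Suc i)" "q = int j"
          by (metis nonneg_int_cases pos_int_cases gr0_implies_Suc)
        moreover from this have "nat (1 + int i) = Suc i"
          by simp
        ultimately show ?thesis
          using True embedding_coeff_intertwines(1)[of l i j]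
          by (simp add: N1_def U_def T1_def weighted_pullback_def \<phi>\<psi> m c1_def s1_def d_def t_def
              flip: of_real_mult mult.assoc)
      next
        case False
        then show ?thesis
          by (auto simp: N1_def U_def T1_def weighted_pullback_def \<phi>\<psi> m c1_def s1_def d_def t_def)
      qed
    qed
    show "N2 (U f) = U (T2 f)"
    proof
      fix m
      obtain p q l where m: "\<phi> m = (p, q, l)"
        by (cases "\<phi> m")
      show "N2 (U f) m = U (T2 f) m"
      proof (cases "0 \<le> p \<and> 0 < q \<and> l < n")
        case True
        then obtain i j where "p = int i" "q = int (Suc j)"
          by (metis nonneg_int_cases pos_int_cases gr0_implies_Suc)
        moreover from this have "nat (1 + int j) = Suc j"
          by simp
        ultimately show ?thesis
          using True embedding_coeff_intertwines(2)[of l i j]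
          by (simp add: N2_def U_def T2_def weighted_pullback_def \<phi>\<psi> m c2_def s2_def d_def t_def
              flip: of_real_mult mult.assoc)
      next
        case False
        then show ?thesis
          by (auto simp: N2_def U_def T2_def weighted_pullback_def \<phi>\<psi> m c2_def s2_def d_def t_def)
      qed
    qed
  qed
  moreover have "N1 ` (U ` ell2) \<subseteq> U ` ell2" "N2 ` (U ` ell2) \<subseteq> U ` ell2"
    using weighted_shift_T by (auto simp: NU weighted_shift_def bounded_op_def)
  ultimately show ?thesis
    unfolding subnormal_pair_def by blast
qed

end

section \<open>Flat extension and subnormal completion\<close>

theorem theorem5p1:
  fixes \<alpha> \<beta> :: "nat \<times> nat \<Rightarrow> real"
  assumes "commutative_family 1 \<alpha> \<beta>"
    and "psd (M_quadratic \<alpha> \<beta>)"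
  shows "(\<exists>\<alpha>' \<beta>'. commutative_family 3 \<alpha>' \<beta>' \<and> agree_upto 1 \<alpha> \<beta> \<alpha>' \<beta>' \<and>
            rank (M_quartic \<alpha>' \<beta>') = rank (M_quadratic \<alpha> \<beta>) \<and>
            psd (M_x \<alpha>' \<beta>') \<and> psd (M_y \<alpha>' \<beta>')) \<and>
         has_subnormal_completion 1 \<alpha> \<beta>"
proof -
  have "0 < \<alpha> k" "0 < \<beta> k" if "k \<in> {(0, 0), (1, 0), (0, 1)}" for k
    using assms(1) that by (auto simp: commutative_family_def deg_def)
  then have pos: "0 < moment \<alpha> \<beta> (0, 1)" "0 < moment \<alpha> \<beta> (1, 0)" "0 < moment \<alpha> \<beta> (0, 2)"
    "0 < moment \<alpha> \<beta> (1, 1)" "0 < moment \<alpha> \<beta> (2, 0)"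
    by (simp_all add: moment_def numeral_2_eq_2)
  obtain n w x y where
    atoms: "\<And>l. l < n \<Longrightarrow> 0 < w l \<and> 0 \<le> x l \<and> 0 \<le> y l" and
    mass: "atomic_moment n w x y (0, 0) = 1" and
    moments: "atomic_moment n w x y (0, 1) = moment \<alpha> \<beta> (0, 1)"
      "atomic_moment n w x y (1, 0) = moment \<alpha> \<beta> (1, 0)"
      "atomic_moment n w x y (0, 2) = moment \<alpha> \<beta> (0, 2)"
      "atomic_moment n w x y (1, 1) = moment \<alpha> \<beta> (1, 1)"
      "atomic_moment n w x y (2, 0) = moment \<alpha> \<beta> (2, 0)" and
    interpolating: "affinely_interpolating n x y"
    using quadratic_moment_problem[OF pos psd_M_quadratic_form[OF assms(2)]] by blast
  interpret \<mu>: quadrant_measure n w x y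
    by unfold_locales (use atoms mass moments pos in auto)
  have agree: "agree_upto 1 \<alpha> \<beta> \<mu>.\<alpha> \<mu>.\<beta>"
    by (rule \<mu>.agree_upto_weights[OF assms(1) moments])
  have "rank (M_quartic \<mu>.\<alpha> \<mu>.\<beta>) = rank (M_quadratic \<alpha> \<beta>)"
    using \<mu>.rank_M_quartic[OF interpolating] agree_upto_M_quadratic[OF agree] by simp
  then show ?thesis
    using \<mu>.commutative_weights agree \<mu>.psd_localizing \<mu>.weighted_shift_T \<mu>.subnormal_T
    unfolding has_subnormal_completion_def by blast
qed

end
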